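(* Let $(X,d)$ and $(Y,e)$ be metric spaces, $E\subseteq X$, $f:E\to Y$. Let $K,L\subseteq\mathbb N$ and $\alpha:K\to X$, $\beta:L\to Y$ with $\mathrm{rng}(\alpha)$ dense in $X$ and $\mathrm{rng}(\beta)$ dense in $Y$, and let $r_0,r_1,\ldots$ be a computable sequence of positive rationals having $0$ as an accumulation point. If there exists a recursively enumerable metric $(\alpha,\beta)$-approximation system for $f$, then $f$ is $(\alpha,\beta)$-computable.
   Context: A metric $(\alpha,\beta)$-approximation system for $f$ is a subset $S\subseteq K\times\mathbb N\times L\times\mathbb N$ such that for every $x\in E$: (a) for all $(k,m,l,n)\in S$, if $d(\alpha(k),x)<r_m$ then $e(\beta(l),f(x))<r_n$; (b) for every $n\in\mathbb N$ there is $m\in\mathbb N$ such that for every $k\in K$ with $d(\alpha(k),x)<r_m$ there exists $l$ with $(k,m,l,n)\in S$. An $\alpha$-name of $x\in X$ is a total function $u:\mathbb N\to K$ with $d(\alpha(u(t)),x)<r_t$ for all $t$; a $\beta$-name of $y\in Y$ is a total $v:\mathbb N\to L$ with $e(\beta(v(t)),y)<r_t$ for all $t$. $f$ is $(\alpha,\beta)$-computable if there is a recursive operator $F$ (on unary partial functions on $\mathbb N$) such that $F(u)$ is a $\beta$-name of $f(x)$ whenever $x\in E$ and $u$ is an $\alpha$-name of $x$. *)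

theory Defs
  imports "HOL-Analysis.Abstract_Metric_Spaces" "HOL-Library.Nat_Bijection"
begin

text \<open>Kleene's partial recursive functions. An \<open>n\<close>-ary partial function is a map on lists of
  which only the values on lists of length \<open>n\<close> matter; this is the content of the rule \<open>ext\<close>.\<close>

definition minimize :: "(nat \<rightharpoonup> nat) \<Rightarrow> nat option" where
  "minimize p =
     (if \<exists>y. p y = Some 0 \<and> (\<forall>z<y. \<exists>v>0. p z = Some v)
      then Some (LEAST y. p y = Some 0) else None)"

inductive partial_recursive :: "nat \<Rightarrow> (nat list \<rightharpoonup> nat) \<Rightarrow> bool" where
  zero: "partial_recursive n (\<lambda>xs. Some 0)"
| succ: "partial_recursive 1 (\<lambda>xs. Some (Suc (xs ! 0)))"
| proj: "i < n \<Longrightarrow> partial_recursive n (\<lambda>xs. Some (xs ! i))"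
| comp: "partial_recursive (length gs) f \<Longrightarrow> \<forall>g\<in>set gs. partial_recursive n g \<Longrightarrow>
    partial_recursive n
      (\<lambda>xs. if \<forall>g\<in>set gs. g xs \<noteq> None then f (map (\<lambda>g. the (g xs)) gs) else None)"
| prim_rec: "partial_recursive n f \<Longrightarrow> partial_recursive (n + 2) g \<Longrightarrow>
    partial_recursive (n + 1)
      (\<lambda>xs. rec_nat (f (tl xs)) (\<lambda>i r. Option.bind r (\<lambda>v. g (i # v # tl xs))) (hd xs))"
| mu: "partial_recursive (n + 1) f \<Longrightarrow>
    partial_recursive n (\<lambda>xs. minimize (\<lambda>y. f (y # xs)))"
| ext: "partial_recursive n f \<Longrightarrow> (\<And>xs. length xs = n \<Longrightarrow> g xs = f xs) \<Longrightarrow> partial_recursive n g"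

definition recursive_function :: "(nat \<Rightarrow> nat) \<Rightarrow> bool" where
  "recursive_function g \<longleftrightarrow> partial_recursive 1 (\<lambda>xs. Some (g (xs ! 0)))"

definition recursively_enumerable :: "nat set \<Rightarrow> bool" where
  "recursively_enumerable A \<longleftrightarrow> A = {} \<or> (\<exists>g. recursive_function g \<and> A = range g)"

definition quad_encode :: "nat \<times> nat \<times> nat \<times> nat \<Rightarrow> nat" where
  "quad_encode = (\<lambda>(k, m, l, n).
     prod_encode (k, prod_encode (m, prod_encode (l, n))))"

definition recursively_enumerable4 :: "(nat \<times> nat \<times> nat \<times> nat) set \<Rightarrow> bool" where
  "recursively_enumerable4 S \<longleftrightarrow> recursively_enumerable (quad_encode ` S)"

text \<open>Enumeration operators and recursive operators as in Rogers: a recursive operator is a map,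
  defined on all unary partial functions, that is induced on graphs by an enumeration operator.
  Finite sets are coded by their canonical indices (\<open>set_encode\<close>).\<close>

definition enumeration_operator :: "nat set \<Rightarrow> nat set \<Rightarrow> nat set" where
  "enumeration_operator W A =
     {a. \<exists>D. finite D \<and> D \<subseteq> A \<and> prod_encode (a, set_encode D) \<in> W}"

definition recursive_operator :: "((nat \<rightharpoonup> nat) \<Rightarrow> (nat \<rightharpoonup> nat)) \<Rightarrow> bool" where
  "recursive_operator F \<longleftrightarrow>
     (\<exists>W. recursively_enumerable W \<and>
       (\<forall>u. prod_encode ` Map.graph (F u) =
            enumeration_operator W (prod_encode ` Map.graph u)))"

definition computable_pos_rat_seq :: "(nat \<Rightarrow> rat) \<Rightarrow> bool" where
  "computable_pos_rat_seq r \<longleftrightarrow>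
     (\<exists>p q. recursive_function p \<and> recursive_function q \<and>
       (\<forall>n. p n > 0 \<and> q n > 0 \<and> r n = of_nat (p n) / of_nat (q n)))"

definition accumulation_point :: "(nat \<Rightarrow> real) \<Rightarrow> real \<Rightarrow> bool" where
  "accumulation_point s a \<longleftrightarrow> (\<forall>\<epsilon>>0. \<exists>\<^sub>F n in sequentially. \<bar>s n - a\<bar> < \<epsilon>)"

text \<open>A name is total: it is a map \<open>u\<close> that is defined, with a value in \<open>K\<close>, at every argument.\<close>

definition is_name ::
  "('a \<Rightarrow> 'a \<Rightarrow> real) \<Rightarrow> (nat \<Rightarrow> rat) \<Rightarrow> nat set \<Rightarrow> (nat \<Rightarrow> 'a) \<Rightarrow> (nat \<rightharpoonup> nat) \<Rightarrow> 'a \<Rightarrow> bool" where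
  "is_name d r K \<alpha> u x \<longleftrightarrow>
     (\<forall>t. \<exists>k\<in>K. u t = Some k \<and> d (\<alpha> k) x < real_of_rat (r t))"

definition metric_approximation_system ::
  "('a \<Rightarrow> 'a \<Rightarrow> real) \<Rightarrow> ('b \<Rightarrow> 'b \<Rightarrow> real) \<Rightarrow> (nat \<Rightarrow> rat) \<Rightarrow>
   nat set \<Rightarrow> (nat \<Rightarrow> 'a) \<Rightarrow> nat set \<Rightarrow> (nat \<Rightarrow> 'b) \<Rightarrow> 'a set \<Rightarrow> ('a \<Rightarrow> 'b) \<Rightarrow>
   (nat \<times> nat \<times> nat \<times> nat) set \<Rightarrow> bool" where
  "metric_approximation_system d e r K \<alpha> L \<beta> E f S \<longleftrightarrow>
     S \<subseteq> K \<times> UNIV \<times> L \<times> UNIV \<and>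
     (\<forall>x\<in>E.
       (\<forall>(k, m, l, n)\<in>S.
          d (\<alpha> k) x < real_of_rat (r m) \<longrightarrow> e (\<beta> l) (f x) < real_of_rat (r n)) \<and>
       (\<forall>n. \<exists>m. \<forall>k\<in>K. d (\<alpha> k) x < real_of_rat (r m) \<longrightarrow> (\<exists>l. (k, m, l, n) \<in> S)))"

definition computable_map ::
  "('a \<Rightarrow> 'a \<Rightarrow> real) \<Rightarrow> ('b \<Rightarrow> 'b \<Rightarrow> real) \<Rightarrow> (nat \<Rightarrow> rat) \<Rightarrow>
   nat set \<Rightarrow> (nat \<Rightarrow> 'a) \<Rightarrow> nat set \<Rightarrow> (nat \<Rightarrow> 'b) \<Rightarrow> 'a set \<Rightarrow> ('a \<Rightarrow> 'b) \<Rightarrow> bool" where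
  "computable_map d e r K \<alpha> L \<beta> E f \<longleftrightarrow>
     (\<exists>F. recursive_operator F \<and>
       (\<forall>x\<in>E. \<forall>u. is_name d r K \<alpha> u x \<longrightarrow> is_name e r L \<beta> (F u) (f x)))"

end

(* Given an enumeration g of S, compute F(u)(n) by running through g(0), g(1), ...; whenever the
   entry g(s) codes a quadruple (k,m,l,n) with last component n, query u(m), and stop with output l
   as soon as u(m) = k. Diverging on an undefined query keeps F(u) single-valued for
   every partial u. If u is a name of x, condition (b) guarantees that the search ends, and
   condition (a) that its result is correct. *)

theory Submission imports Defs begin

section \<open>Total recursive functions and decidable predicates\<close>

text \<open>Plain values instead of options: a term can then be shown recursive by following its
  syntax, with no side conditions on definedness.\<close>

definition total_recursive :: "nat \<Rightarrow> (nat list \<Rightarrow> nat) \<Rightarrow> bool" where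
  "total_recursive n f \<longleftrightarrow> partial_recursive n (\<lambda>xs. Some (f xs))"

definition decidable :: "nat \<Rightarrow> (nat list \<Rightarrow> bool) \<Rightarrow> bool" where
  "decidable n P \<longleftrightarrow> total_recursive n (\<lambda>xs. of_bool (P xs))"

named_theorems recursive_intros

section \<open>Closure under composition and primitive recursion\<close>

lemma total_recursive_cong:
  assumes "total_recursive n f" "\<And>xs. length xs = n \<Longrightarrow> g xs = f xs"
  shows "total_recursive n g"
  using assms unfolding total_recursive_def
  by (auto intro: partial_recursive.ext)

lemma total_recursive_comp:
  assumes "total_recursive (length gs) f" "\<And>g. g \<in> set gs \<Longrightarrow> total_recursive n g"
  shows "total_recursive n (\<lambda>xs. f (map (\<lambda>g. g xs) gs))"
proof -
  let ?gs = "map (\<lambda>g xs. Some (g xs)) gs"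
  have "partial_recursive n
    (\<lambda>xs. if \<forall>g\<in>set ?gs. g xs \<noteq> None then Some (f (map (\<lambda>g. the (g xs)) ?gs)) else None)"
    using assms by (intro partial_recursive.comp) (auto simp: total_recursive_def)
  then show ?thesis
    by (simp add: total_recursive_def comp_def)
qed

lemma total_recursive_apply:
  assumes "recursive_function g" "total_recursive n a"
  shows "total_recursive n (\<lambda>xs. g (a xs))"
  using total_recursive_comp[of "[a]" "\<lambda>xs. g (xs ! 0)" n] assms
  by (simp add: recursive_function_def total_recursive_def)

lemma total_recursive_nth [recursive_intros]:
  "i < n \<Longrightarrow> total_recursive n (\<lambda>xs. xs ! i)"
  unfolding total_recursive_def by (rule partial_recursive.proj)

lemma total_recursive_hd [recursive_intros]:
  "0 < n \<Longrightarrow> total_recursive n hd"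
  by (rule total_recursive_cong[OF total_recursive_nth[of 0]]) (auto simp: hd_conv_nth)

lemma total_recursive_Suc [recursive_intros]:
  "total_recursive n a \<Longrightarrow> total_recursive n (\<lambda>xs. Suc (a xs))"
  using total_recursive_apply[of Suc] partial_recursive.succ by (simp add: recursive_function_def)

lemma total_recursive_zero: "total_recursive n (\<lambda>xs. 0)"
  unfolding total_recursive_def by (rule partial_recursive.zero)

lemma total_recursive_const [recursive_intros]: "total_recursive n (\<lambda>xs. c)"
  by (induction c) (auto intro: total_recursive_zero total_recursive_Suc)

text \<open>Bound variables are kept at the front of the argument list, as with de Bruijn indices;
  this weakening rule carries a function of the outer arguments under a binder.\<close>

lemma total_recursive_tl [recursive_intros]:
  assumes "total_recursive n f"
  shows "total_recursive (Suc n) (\<lambda>xs. f (tl xs))"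
proof -
  let ?gs = "map (\<lambda>i xs. xs ! Suc i) [0..<n]"
  have "total_recursive (Suc n) (\<lambda>xs. f (map (\<lambda>g. g xs) ?gs))"
    using assms by (intro total_recursive_comp) (auto intro: total_recursive_nth)
  then show ?thesis
    by (rule total_recursive_cong) (auto intro!: arg_cong[of _ _ f] nth_equalityI simp: nth_tl)
qed

lemma total_recursive_rec_nat [recursive_intros]:
  assumes "total_recursive n z"
    and "total_recursive (Suc (Suc n)) (\<lambda>ys. s (hd ys) (hd (tl ys)) (tl (tl ys)))"
    and "total_recursive n b"
  shows "total_recursive n (\<lambda>xs. rec_nat (z xs) (\<lambda>i v. s i v xs) (b xs))"
proof -
  \<comment> \<open>Composing with \<open>b\<close> followed by all projections turns recursion on
    the head of the list into recursion on \<open>b xs\<close> with \<open>xs\<close> as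
    parameters.\<close>
  let ?gs = "b # map (\<lambda>i xs. xs ! i) [0..<n]"
  \<comment> \<open>A total step function keeps every stage of the recursion defined, so the option
    layer disappears.\<close>
  have bind: "rec_nat (Some v) (\<lambda>i r. Option.bind r (\<lambda>v. Some (t i v))) m = Some (rec_nat v t m)"
    for v m :: nat and t
    by (induction m) auto
  have "partial_recursive (n + 1) (\<lambda>xs. rec_nat (Some (z (tl xs)))
      (\<lambda>i r. Option.bind r (\<lambda>v. Some (s (hd (i # v # tl xs)) (hd (tl (i # v # tl xs)))
        (tl (tl (i # v # tl xs)))))) (hd xs))"
    using assms(1,2) unfolding total_recursive_def by (intro partial_recursive.prim_rec) simp_all
  then have "total_recursive (length ?gs) (\<lambda>xs. rec_nat (z (tl xs)) (\<lambda>i v. s i v (tl xs)) (hd xs))"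
    by (simp add: bind total_recursive_def)
  then have "total_recursive n (\<lambda>xs. (\<lambda>xs. rec_nat (z (tl xs)) (\<lambda>i v. s i v (tl xs)) (hd xs))
      (map (\<lambda>g. g xs) ?gs))"
    using assms(3) by (intro total_recursive_comp) (auto intro: total_recursive_nth)
  moreover have "map ((!) xs) [0..<length xs] = xs" for xs :: "nat list"
    by (rule map_nth)
  ultimately show ?thesis
    by (elim total_recursive_cong) (auto simp: comp_def)
qed

section \<open>Arithmetic\<close>

lemma total_recursive_add [recursive_intros]:
  assumes "total_recursive n a" "total_recursive n b"
  shows "total_recursive n (\<lambda>xs. a xs + b xs)"
proof -
  have "rec_nat x (\<lambda>_ v. Suc v) y = x + y" for x y
    by (induction y) auto
  then show ?thesis
    using total_recursive_rec_nat[of n a "\<lambda>_ v _. Suc v" b] assms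
    by (simp add: recursive_intros)
qed

lemma total_recursive_diff [recursive_intros]:
  assumes "total_recursive n a" "total_recursive n b"
  shows "total_recursive n (\<lambda>xs. a xs - b xs)"
proof -
  \<comment> \<open>The step ignores the previous value and returns the counter: this is the
    predecessor, with 0 sent to 0. Iterating it gives truncated subtraction.\<close>
  have pred: "rec_nat 0 (\<lambda>i _. i) y = y - 1" for y
    by (cases y) auto
  have "total_recursive m (\<lambda>xs. c xs - 1)" if "total_recursive m c" for m c
    using total_recursive_rec_nat[of m "\<lambda>_. 0" "\<lambda>i _ _. i" c] that
    by (simp add: recursive_intros pred)
  moreover have "rec_nat x (\<lambda>_ v. v - 1) y = x - y" for x y :: nat
    by (induction y) auto
  ultimately show ?thesis
    using total_recursive_rec_nat[of n a "\<lambda>_ v _. v - 1" b] assms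
    by (simp add: recursive_intros)
qed

lemma total_recursive_sum [recursive_intros]:
  assumes "total_recursive (Suc n) (\<lambda>ys. f (hd ys) (tl ys))" "total_recursive n b"
  shows "total_recursive n (\<lambda>xs. \<Sum>i<b xs. f i xs)"
proof -
  \<comment> \<open>The list in a recursion step consists of counter, running total and parameters;
    these projections leave out the running total, on which the summand does not depend.\<close>
  let ?gs = "hd # map (\<lambda>i xs. xs ! Suc (Suc i)) [0..<n]"
  have "total_recursive (Suc (Suc n))
      (\<lambda>xs. (\<lambda>ys. f (hd ys) (tl ys)) (map (\<lambda>g. g xs) ?gs))"
    using assms(1) by (intro total_recursive_comp) (auto intro: recursive_intros)
  then have "total_recursive (Suc (Suc n)) (\<lambda>xs. f (hd xs) (tl (tl xs)))"
    by (rule total_recursive_cong)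
      (auto intro!: arg_cong[of _ _ "f _"] nth_equalityI simp: nth_tl)
  then have "total_recursive n (\<lambda>xs. rec_nat 0 (\<lambda>i v. v + f i xs) (b xs))"
    by (intro recursive_intros assms(2)) simp
  moreover have "rec_nat 0 (\<lambda>i v. v + t i) m = (\<Sum>i<m. t i)" for t :: "nat \<Rightarrow> nat" and m
    by (induction m) auto
  ultimately show ?thesis
    by simp
qed

lemma total_recursive_mult [recursive_intros]:
  assumes "total_recursive n a" "total_recursive n b"
  shows "total_recursive n (\<lambda>xs. a xs * b xs)"
  using total_recursive_sum[of n "\<lambda>_ xs. b xs" a] assms by (simp add: recursive_intros)

lemma total_recursive_power [recursive_intros]:
  assumes "total_recursive n a" "total_recursive n b"
  shows "total_recursive n (\<lambda>xs. a xs ^ b xs)"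
proof -
  have "rec_nat 1 (\<lambda>_ v. x * v) y = x ^ y" for x y :: nat
    by (induction y) auto
  then show ?thesis
    using total_recursive_rec_nat[of n "\<lambda>_. 1" "\<lambda>_ v xs. a xs * v" b] assms
    by (simp add: total_recursive_mult total_recursive_const total_recursive_hd
        total_recursive_tl[of _ hd] total_recursive_tl[of _ "\<lambda>xs. a (tl xs)"]
        total_recursive_tl[of _ a])
qed

section \<open>Boolean operations, comparisons and bounded quantifiers\<close>

lemma decidable_not [recursive_intros]:
  assumes "decidable n P"
  shows "decidable n (\<lambda>xs. \<not> P xs)"
proof -
  have "total_recursive n (\<lambda>xs. 1 - of_bool (P xs))"
    using assms unfolding decidable_def by (intro recursive_intros)
  then show ?thesis
    unfolding decidable_def by (rule total_recursive_cong) auto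
qed

lemma decidable_conj [recursive_intros]:
  "decidable n P \<Longrightarrow> decidable n Q \<Longrightarrow> decidable n (\<lambda>xs. P xs \<and> Q xs)"
  unfolding decidable_def of_bool_conj by (intro recursive_intros)

lemma decidable_imp [recursive_intros]:
  "decidable n P \<Longrightarrow> decidable n Q \<Longrightarrow> decidable n (\<lambda>xs. P xs \<longrightarrow> Q xs)"
  using decidable_not[OF decidable_conj[of n P "\<lambda>xs. \<not> Q xs"]] decidable_not[of n Q] by simp

lemma decidable_le [recursive_intros]:
  assumes "total_recursive n a" "total_recursive n b"
  shows "decidable n (\<lambda>xs. a xs \<le> b xs)"
proof -
  have "total_recursive n (\<lambda>xs. 1 - (a xs - b xs))"
    using assms by (intro recursive_intros)
  then show ?thesis
    unfolding decidable_def by (rule total_recursive_cong) auto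
qed

lemma decidable_less [recursive_intros]:
  "total_recursive n a \<Longrightarrow> total_recursive n b \<Longrightarrow> decidable n (\<lambda>xs. a xs < b xs)"
  unfolding less_eq_Suc_le by (intro recursive_intros)

lemma decidable_eq [recursive_intros]:
  "total_recursive n a \<Longrightarrow> total_recursive n b \<Longrightarrow> decidable n (\<lambda>xs. a xs = b xs)"
  unfolding eq_iff by (intro recursive_intros)

text \<open>Adding up the characteristic values counts the witnesses below the bound, and one exists
  exactly if the count is positive.\<close>

lemma decidable_bounded_ex [recursive_intros]:
  assumes "decidable (Suc n) (\<lambda>ys. P (hd ys) (tl ys))" "total_recursive n b"
  shows "decidable n (\<lambda>xs. \<exists>i<b xs. P i xs)"
proof -
  have "decidable n (\<lambda>xs. 0 < (\<Sum>i<b xs. of_bool (P i xs) :: nat))"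
    using assms by (intro recursive_intros) (simp_all add: decidable_def)
  moreover have "0 < (\<Sum>i<m. of_bool (Q i) :: nat) \<longleftrightarrow> (\<exists>i<m. Q i)" for Q and m :: nat
    by (induction m) (auto simp: less_Suc_eq simp del: sum_of_bool_eq)
  ultimately show ?thesis
    by simp
qed

lemma decidable_bounded_all [recursive_intros]:
  assumes "decidable (Suc n) (\<lambda>ys. P (hd ys) (tl ys))" "total_recursive n b"
  shows "decidable n (\<lambda>xs. \<forall>i<b xs. P i xs)"
  using decidable_not[OF decidable_bounded_ex[of n "\<lambda>i xs. \<not> P i xs" b]] assms
  by (simp add: decidable_not)

lemma total_recursive_if [recursive_intros]:
  assumes "decidable n P" "total_recursive n a" "total_recursive n b"
  shows "total_recursive n (\<lambda>xs. if P xs then a xs else b xs)"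
proof -
  have "total_recursive n (\<lambda>xs. of_bool (P xs) * a xs + of_bool (\<not> P xs) * b xs)"
    using assms decidable_not[OF assms(1)] unfolding decidable_def by (intro recursive_intros)
  then show ?thesis
    by (rule total_recursive_cong) auto
qed

section \<open>Codings of pairs and of finite sets\<close>

abbreviation pfst :: "nat \<Rightarrow> nat" where "pfst w \<equiv> fst (prod_decode w)"
abbreviation psnd :: "nat \<Rightarrow> nat" where "psnd w \<equiv> snd (prod_decode w)"

section \<open>The pairing function and its projections\<close>

lemma total_recursive_prod_encode [recursive_intros]:
  assumes "total_recursive n a" "total_recursive n b"
  shows "total_recursive n (\<lambda>xs. prod_encode (a xs, b xs))"
proof -
  \<comment> \<open>\<open>prod_encode\<close> adds a triangular number to the first component;
    written as a sum, that number needs no division.\<close>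
  have "triangle m = (\<Sum>i<Suc m. i)" for m
    by (induction m) auto
  then show ?thesis
    unfolding prod_encode_def using assms by (auto intro!: recursive_intros simp del: sum.lessThan_Suc)
qed

lemma prod_decode_le: "pfst w \<le> w" "psnd w \<le> w"
  using le_prod_encode_1[of "pfst w" "psnd w"] le_prod_encode_2[of "psnd w" "pfst w"] by simp_all

text \<open>Decoding by a sum instead of a search: both components are at most \<open>w\<close>, and
  only the pair coded by \<open>w\<close> contributes. The choice of \<open>f\<close> yields either
  projection.\<close>

lemma prod_decode_sum:
  "(\<Sum>k<Suc w. \<Sum>j<Suc w. if prod_encode (k, j) = w then f k j else 0) = f (pfst w) (psnd w)"
  for f :: "nat \<Rightarrow> nat \<Rightarrow> nat"
proof -
  have "prod_encode p = w \<longleftrightarrow> p = prod_decode w" for p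
    by auto
  then have "(\<Sum>k<Suc w. \<Sum>j<Suc w. if prod_encode (k, j) = w then f k j else 0)
      = (\<Sum>p\<in>{..<Suc w} \<times> {..<Suc w}. if p = prod_decode w then f (fst p) (snd p) else 0)"
    unfolding sum.cartesian_product by (intro sum.cong) (auto simp: case_prod_unfold)
  also have "\<dots> = f (pfst w) (psnd w)"
    using prod_decode_le[of w] by (subst sum.delta) (auto simp: mem_Times_iff less_Suc_eq_le)
  finally show ?thesis .
qed

lemma total_recursive_pfst [recursive_intros]:
  assumes "total_recursive n a"
  shows "total_recursive n (\<lambda>xs. pfst (a xs))"
  unfolding prod_decode_sum[where f = "\<lambda>k j. k", symmetric]
  by (intro recursive_intros assms) simp_all

lemma total_recursive_psnd [recursive_intros]:
  assumes "total_recursive n a"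
  shows "total_recursive n (\<lambda>xs. psnd (a xs))"
  unfolding prod_decode_sum[where f = "\<lambda>k j. j", symmetric]
  by (intro recursive_intros assms) simp_all

text \<open>Membership means that \<open>D div 2 ^ x\<close> is an odd number
  \<open>2 * q + 1\<close>. Two inequalities pin down this quotient, which leaves only sums,
  products, powers and a bounded quantifier.\<close>

lemma mem_set_decode_iff:
  "x \<in> set_decode D \<longleftrightarrow> (\<exists>q<Suc D. (2 * q + 1) * 2 ^ x \<le> D \<and> D < (2 * q + 2) * 2 ^ x)"
proof
  assume "x \<in> set_decode D"
  then obtain q where q: "D div 2 ^ x = 2 * q + 1"
    by (auto simp: set_decode_def elim: oddE)
  have "2 * q + 1 \<le> D"
    unfolding q[symmetric] by (rule div_le_dividend)
  moreover have "(2 * q + 1) * 2 ^ x \<le> D"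
    unfolding q[symmetric] by simp
  moreover have "D < (2 * q + 2) * 2 ^ x"
    using dividend_less_div_times[of "2 ^ x" D] by (simp add: q algebra_simps)
  ultimately show "\<exists>q<Suc D. (2 * q + 1) * 2 ^ x \<le> D \<and> D < (2 * q + 2) * 2 ^ x"
    by (intro exI[of _ q]) auto
next
  assume "\<exists>q<Suc D. (2 * q + 1) * 2 ^ x \<le> D \<and> D < (2 * q + 2) * 2 ^ x"
  then obtain q where "(2 * q + 1) * 2 ^ x \<le> D" "D < (2 * q + 2) * 2 ^ x"
    by blast
  then have "D div 2 ^ x = 2 * q + 1"
    by (intro div_nat_eqI) (auto simp: algebra_simps)
  then show "x \<in> set_decode D"
    by (simp add: set_decode_def)
qed

lemma decidable_mem_set_decode [recursive_intros]:
  assumes "total_recursive n a" "total_recursive n b"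
  shows "decidable n (\<lambda>xs. a xs \<in> set_decode (b xs))"
  unfolding mem_set_decode_iff
  by (intro recursive_intros assms) simp_all

text \<open>A set bit gives \<open>2 ^ x \<le> D\<close>, and \<open>x < 2 ^ x\<close>. This bounds
  the values that can occur in the set with canonical index \<open>D\<close>.\<close>

lemma mem_set_decode_less:
  assumes "x \<in> set_decode D"
  shows "x < D"
proof -
  have "2 ^ x \<le> D"
    using assms by (cases "D < 2 ^ x") (simp_all add: set_decode_def)
  then show ?thesis
    using less_exp[of x] by (rule order_less_le_trans[rotated])
qed

text \<open>A fixed witness \<open>c\<close> of \<open>P\<close> fills the gaps: numbers outside
  \<open>P\<close> are sent to \<open>h c\<close>, so the enumeration is total. Without a witness
  the set is empty.\<close>

lemma recursively_enumerable_decidable_image: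
  assumes "decidable 1 (\<lambda>xs. P (xs ! 0))" "recursive_function h"
  shows "recursively_enumerable {h w | w. P w}"
proof (cases "\<exists>w. P w")
  case True
  then obtain c where c: "P c"
    by blast
  have "total_recursive 1 (\<lambda>xs. if P (xs ! 0) then h (xs ! 0) else h c)"
    by (intro recursive_intros assms(1) total_recursive_apply[OF assms(2)]) simp_all
  then have "recursive_function (\<lambda>w. if P w then h w else h c)"
    by (simp add: recursive_function_def total_recursive_def)
  moreover have "{h w | w. P w} = range (\<lambda>w. if P w then h w else h c)"
    using c by (auto simp: image_iff)
  ultimately show ?thesis
    unfolding recursively_enumerable_def by blast
qed (simp add: recursively_enumerable_def)

section \<open>The search operator\<close>

definition quad_decode :: "nat \<Rightarrow> nat \<times> nat \<times> nat \<times> nat" where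
  "quad_decode w = (pfst w, pfst (psnd w), pfst (psnd (psnd w)), psnd (psnd (psnd w)))"

lemma quad_decode_encode [simp]: "quad_decode (quad_encode q) = q"
  by (cases q) (simp add: quad_decode_def quad_encode_def)

text \<open>An entry aimed at another index is passed over at once; otherwise its query must have
  been answered, by some \<open>v\<close> different from \<open>k\<close>. Asking for such a
  positive answer, rather than for the absence of \<open>(m, k)\<close>, makes the condition
  monotone in \<open>A\<close> and models divergence on an undefined query.\<close>

definition refuted :: "(nat \<times> nat) set \<Rightarrow> nat \<times> nat \<times> nat \<times> nat \<Rightarrow> nat \<Rightarrow> bool" where
  "refuted A = (\<lambda>(k, m, l, n') n. n' = n \<longrightarrow> (\<exists>v. v \<noteq> k \<and> (m, v) \<in> A))"

text \<open>The relation \<open>A\<close> is the oracle: the whole graph of a partial function, or a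
  finite part of it. The second conjunct says that the search gets as far as stage
  \<open>s\<close>.\<close>

definition found ::
  "(nat \<Rightarrow> nat \<times> nat \<times> nat \<times> nat) \<Rightarrow> (nat \<times> nat) set \<Rightarrow> nat \<Rightarrow> nat \<Rightarrow> nat \<Rightarrow> bool" where
  "found q A s n l \<longleftrightarrow>
     (\<exists>k m. q s = (k, m, l, n) \<and> (m, k) \<in> A) \<and> (\<forall>s'<s. refuted A (q s') n)"

text \<open>The oracle \<open>A\<close> occurs only positively, also inside
  \<open>refuted\<close>.\<close>

lemma found_mono: "found q A s n l \<Longrightarrow> A \<subseteq> B \<Longrightarrow> found q B s n l"
  unfolding found_def refuted_def by (fastforce split: prod.splits)

text \<open>A halting search rests on finitely many oracle answers: the match at stage
  \<open>s\<close> and at most one refuting answer for each earlier stage.\<close>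

lemma found_finite:
  assumes "found q A s n l"
  obtains B where "finite B" "B \<subseteq> A" "found q B s n l"
proof -
  obtain k m where km: "q s = (k, m, l, n)" "(m, k) \<in> A"
    using assms by (auto simp: found_def)
  have "\<forall>s'\<in>{..<s}. \<exists>p. (\<exists>k m l n'. q s' = (k, m, l, n') \<and> n' = n) \<longrightarrow> p \<in> A \<and> refuted {p} (q s') n"
    using assms by (fastforce simp: found_def refuted_def split: prod.splits)
  then obtain p where p: "\<forall>s'\<in>{..<s}. (\<exists>k m l n'. q s' = (k, m, l, n') \<and> n' = n) \<longrightarrow>
      p s' \<in> A \<and> refuted {p s'} (q s') n"
    by (rule bchoice[THEN exE])
  \<comment> \<open>At stages aimed at another index the pair \<open>p s'\<close> is unconstrained
    and may lie outside \<open>A\<close>, hence the intersection.\<close>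
  let ?B = "insert (m, k) (p ` {..<s}) \<inter> A"
  have "refuted ?B (q s') n" if "s' < s" for s'
    using p that by (fastforce simp: refuted_def split: prod.splits)
  then have "found q ?B s n l"
    using km by (auto simp: found_def)
  then show thesis
    using that[of ?B] by auto
qed

text \<open>At the earlier of two halting stages, \<open>A\<close> would hold both the matching
  answer \<open>k\<close> and a different, refuting answer to the same query, against
  single-valuedness. So the stages agree, and with them the outputs.\<close>

lemma found_unique:
  assumes "single_valued A" "found q A s n l" "found q A s' n l'"
  shows "l = l'"
proof -
  have aux: "\<not> s1 < s2" if f: "found q A s1 n l1" "found q A s2 n l2" for s1 s2 l1 l2
  proof
    assume "s1 < s2"
    then have "refuted A (q s1) n"
      using f(2) by (simp add: found_def)
    moreover obtain k m where "q s1 = (k, m, l1, n)" "(m, k) \<in> A"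
      using f(1) by (auto simp: found_def)
    ultimately show False
      using assms(1) by (auto simp: refuted_def dest: single_valuedD)
  qed
  then have "s = s'"
    using assms(2,3) by (metis linorder_neqE_nat)
  then show ?thesis
    using assms(2,3) by (auto simp: found_def)
qed

definition search_operator ::
  "(nat \<Rightarrow> nat \<times> nat \<times> nat \<times> nat) \<Rightarrow> (nat \<rightharpoonup> nat) \<Rightarrow> (nat \<rightharpoonup> nat)" where
  "search_operator q u n =
     (if \<exists>s l. found q (Map.graph u) s n l then Some (THE l. \<exists>s. found q (Map.graph u) s n l)
      else None)"

text \<open>Graphs of partial functions are single-valued, so by \<open>found_unique\<close> the
  definite description picks out the output of the search.\<close>

lemma search_operator_eq_Some_iff:
  "search_operator q u n = Some l \<longleftrightarrow> (\<exists>s. found q (Map.graph u) s n l)"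
proof -
  have "single_valued (Map.graph u)"
    by (auto simp: single_valued_def Map.graph_def)
  then have the: "(THE l. \<exists>s. found q (Map.graph u) s n l) = l" if "found q (Map.graph u) s n l" for s l
    using that found_unique by (intro the_equality) blast+
  show ?thesis
  proof (cases "\<exists>s l. found q (Map.graph u) s n l")
    case True
    then show ?thesis
      unfolding search_operator_def using the by auto
  qed (simp add: search_operator_def)
qed

text \<open>For a finite oracle given by its canonical index, the refuting value \<open>v\<close>
  can be bounded by \<open>D\<close>; the right-hand side is then decidable when \<open>q\<close>
  decodes the values of a recursive function.\<close>

lemma found_decoded:
  "found q (prod_decode ` set_decode D) s n l \<longleftrightarrow>
     (case q s of (k, m, l', n') \<Rightarrow> l' = l \<and> n' = n \<and> prod_encode (m, k) \<in> set_decode D) \<and>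
     (\<forall>s'<s. case q s' of (k, m, l', n') \<Rightarrow>
        n' = n \<longrightarrow> (\<exists>v<D. v \<noteq> k \<and> prod_encode (m, v) \<in> set_decode D))"
proof -
  let ?A = "prod_decode ` set_decode D"
  have mem: "p \<in> ?A \<longleftrightarrow> prod_encode p \<in> set_decode D" for p
    by (metis imageE image_eqI prod_decode_inverse prod_encode_inverse)
  have less: "v < D" if "prod_encode (m, v) \<in> set_decode D" for m v
    using mem_set_decode_less[OF that] le_prod_encode_2[of v m] by simp
  have "(\<exists>k m. p = (k, m, l, n) \<and> (m, k) \<in> ?A) \<longleftrightarrow>
      (case p of (k, m, l', n') \<Rightarrow> l' = l \<and> n' = n \<and> prod_encode (m, k) \<in> set_decode D)" for p
    unfolding mem by (cases p) auto
  moreover have "refuted ?A p n \<longleftrightarrow> (case p of (k, m, l', n') \<Rightarrow>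
      n' = n \<longrightarrow> (\<exists>v<D. v \<noteq> k \<and> prod_encode (m, v) \<in> set_decode D))" for p
    unfolding refuted_def mem by (cases p) (auto dest: less)
  ultimately show ?thesis
    unfolding found_def by simp
qed

text \<open>The inducing set \<open>W\<close> consists of axioms: output \<open>l\<close> at
  argument \<open>n\<close> follows from a finite set of oracle answers on which the search halts
  with that output.\<close>

lemma recursive_operator_search_operator:
  assumes "recursive_function g"
  shows "recursive_operator (search_operator (\<lambda>s. quad_decode (g s)))"
proof -
  let ?q = "\<lambda>s. quad_decode (g s)"
  let ?l = "\<lambda>s. pfst (psnd (psnd (g s)))" and ?n = "\<lambda>s. psnd (psnd (psnd (g s)))"
  \<comment> \<open>Here \<open>w\<close> codes a stage together with a canonical index. The entry
    at that stage fixes the argument \<open>?n\<close> and the output \<open>?l\<close>, so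
    \<open>w\<close> carries enough data to check an axiom and to write it down.\<close>
  let ?P = "\<lambda>w. found ?q (prod_decode ` set_decode (psnd w)) (pfst w) (?n (pfst w)) (?l (pfst w))"
  let ?h = "\<lambda>w. prod_encode (prod_encode (?n (pfst w), ?l (pfst w)), psnd w)"
  define W where "W = {?h w | w. ?P w}"
  have W: "prod_encode (prod_encode (n, l), set_encode D) \<in> W \<longleftrightarrow>
      (\<exists>s. found ?q (prod_decode ` D) s n l)" if "finite D" for n l D
  proof -
    have nl: "n = ?n s \<and> l = ?l s" if "found ?q A s n l" for A s
      using that by (auto simp: found_def quad_decode_def)
    have D: "set_decode (set_encode D) = D"
      using that by simp
    show ?thesis
    proof
      assume "prod_encode (prod_encode (n, l), set_encode D) \<in> W"
      then obtain w where w: "prod_encode (prod_encode (n, l), set_encode D) = ?h w" "?P w"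
        unfolding W_def by blast
      from w(1) have "n = ?n (pfst w)" "l = ?l (pfst w)" "psnd w = set_encode D"
        by simp_all
      with w(2) D show "\<exists>s. found ?q (prod_decode ` D) s n l"
        by metis
    next
      assume "\<exists>s. found ?q (prod_decode ` D) s n l"
      then obtain s where s: "found ?q (prod_decode ` D) s n l"
        by blast
      let ?w = "prod_encode (s, set_encode D)"
      have "?P ?w" "prod_encode (prod_encode (n, l), set_encode D) = ?h ?w"
        using s nl[OF s] D by simp_all
      then show "prod_encode (prod_encode (n, l), set_encode D) \<in> W"
        unfolding W_def by blast
    qed
  qed
  have "decidable 1 (\<lambda>xs. ?P (xs ! 0))"
    unfolding found_decoded unfolding quad_decode_def prod.case
    by (intro recursive_intros total_recursive_apply[OF assms]) simp_all
  moreover have "recursive_function ?h"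
    unfolding recursive_function_def total_recursive_def[symmetric]
    by (intro recursive_intros total_recursive_apply[OF assms]) simp_all
  ultimately have "recursively_enumerable W"
    unfolding W_def by (rule recursively_enumerable_decidable_image)
  moreover have "prod_encode ` Map.graph (search_operator ?q u) =
      enumeration_operator W (prod_encode ` Map.graph u)" for u
  proof -
    \<comment> \<open>Forwards, \<open>found_mono\<close> enlarges the finite set of an axiom to the
      graph of \<open>u\<close>; backwards, \<open>found_finite\<close> cuts the graph down to a
      finite part.\<close>
    have "prod_encode (n, l) \<in> enumeration_operator W (prod_encode ` Map.graph u) \<longleftrightarrow>
        search_operator ?q u n = Some l" for n l
    proof
      assume "prod_encode (n, l) \<in> enumeration_operator W (prod_encode ` Map.graph u)"
      then obtain D where D: "finite D" "D \<subseteq> prod_encode ` Map.graph u"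
        "prod_encode (prod_encode (n, l), set_encode D) \<in> W"
        by (auto simp: enumeration_operator_def)
      then obtain s where "found ?q (prod_decode ` D) s n l"
        using W by blast
      moreover have "prod_decode ` D \<subseteq> Map.graph u"
        using D(2) by auto
      ultimately show "search_operator ?q u n = Some l"
        unfolding search_operator_eq_Some_iff by (blast intro: found_mono)
    next
      assume "search_operator ?q u n = Some l"
      then obtain s where "found ?q (Map.graph u) s n l"
        by (auto simp: search_operator_eq_Some_iff)
      then obtain B where B: "finite B" "B \<subseteq> Map.graph u" "found ?q B s n l"
        by (rule found_finite)
      then have "prod_encode (prod_encode (n, l), set_encode (prod_encode ` B)) \<in> W"
        by (subst W) (auto simp: image_image)
      then show "prod_encode (n, l) \<in> enumeration_operator W (prod_encode ` Map.graph u)"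
        unfolding enumeration_operator_def
        using B(1,2) by (auto intro!: exI[of _ "prod_encode ` B"])
    qed
    then have mem: "prod_encode p \<in> enumeration_operator W (prod_encode ` Map.graph u) \<longleftrightarrow>
        p \<in> Map.graph (search_operator ?q u)" for p
      by (cases p) (simp add: Map.graph_def)
    show ?thesis
    proof (rule set_eqI)
      fix w
      obtain p where "w = prod_encode p"
        by (metis prod_decode_inverse)
      then show "w \<in> prod_encode ` Map.graph (search_operator ?q u) \<longleftrightarrow>
          w \<in> enumeration_operator W (prod_encode ` Map.graph u)"
        by (simp only: mem inj_image_mem_iff[OF inj_prod_encode])
    qed
  qed
  ultimately show ?thesis
    unfolding recursive_operator_def by blast
qed

text \<open>A matching entry ensures that there is a first one, and as \<open>u\<close> is total,
  every query before it is answered, so every entry before it is refuted. The first match may differ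
  from the given one, hence the new \<open>k'\<close>, \<open>m'\<close>, \<open>l'\<close>.\<close>

lemma search_operator_total:
  assumes "\<And>t. u t \<noteq> None" "q s = (k, m, l, n)" "u m = Some k"
  obtains s' k' m' l' where
    "search_operator q u n = Some l'" "q s' = (k', m', l', n)" "u m' = Some k'"
proof -
  define Q where "Q s \<longleftrightarrow> (\<exists>k m l. q s = (k, m, l, n) \<and> u m = Some k)" for s
  have "Q s"
    using assms(2,3) by (auto simp: Q_def)
  then have "Q (LEAST s. Q s)"
    by (rule LeastI)
  then obtain k' m' l' where s': "q (LEAST s. Q s) = (k', m', l', n)" "u m' = Some k'"
    by (auto simp: Q_def)
  have "refuted (Map.graph u) (q s') n" if "s' < (LEAST s. Q s)" for s'
  proof -
    obtain k m l n' where q: "q s' = (k, m, l, n')"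
      by (cases "q s'")
    moreover obtain v where "u m = Some v"
      using assms(1)[of m] by auto
    \<comment> \<open>Stage \<open>s'\<close> precedes the first match, so if \<open>n' = n\<close>,
      the answer \<open>v\<close> differs from \<open>k\<close>.\<close>
    ultimately show ?thesis
      using not_less_Least[OF that] by (auto simp: Q_def refuted_def Map.graph_def)
  qed
  then have "found q (Map.graph u) (LEAST s. Q s) n l'"
    using s' by (auto simp: found_def Map.graph_def)
  then show thesis
    using that s' search_operator_eq_Some_iff by blast
qed

section \<open>Computability from an approximation system\<close>

theorem theorem3p23:
  fixes X :: "'a set" and d :: "'a \<Rightarrow> 'a \<Rightarrow> real"
    and Y :: "'b set" and e :: "'b \<Rightarrow> 'b \<Rightarrow> real"
    and E :: "'a set" and f :: "'a \<Rightarrow> 'b"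
    and K L :: "nat set" and \<alpha> :: "nat \<Rightarrow> 'a" and \<beta> :: "nat \<Rightarrow> 'b"
    and r :: "nat \<Rightarrow> rat"
  assumes "Metric_space X d" and "Metric_space Y e"
    and "E \<subseteq> X" and "f \<in> E \<rightarrow> Y"
    and "\<alpha> \<in> K \<rightarrow> X" and "\<beta> \<in> L \<rightarrow> Y"
    and "Metric_space.mtopology X d closure_of (\<alpha> ` K) = X"
    and "Metric_space.mtopology Y e closure_of (\<beta> ` L) = Y"
    and "computable_pos_rat_seq r"
    and "accumulation_point (\<lambda>n. real_of_rat (r n)) 0"
    and "\<exists>S. recursively_enumerable4 S \<and> metric_approximation_system d e r K \<alpha> L \<beta> E f S"
  shows "computable_map d e r K \<alpha> L \<beta> E f"
proof -
  obtain S where re: "recursively_enumerable4 S"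
    and S: "metric_approximation_system d e r K \<alpha> L \<beta> E f S"
    using assms(11) by blast
  have accurate: "e (\<beta> l) (f x) < real_of_rat (r n)"
    if "x \<in> E" "(k, m, l, n) \<in> S" "d (\<alpha> k) x < real_of_rat (r m)" for x k m l n
    using S that unfolding metric_approximation_system_def by fast
  \<comment> \<open>Condition (b) supplies \<open>m\<close>; the name answers the query at
    \<open>m\<close> with some \<open>k\<close> in \<open>K\<close> within \<open>r m\<close> of
    \<open>x\<close>, so (b) applies to this \<open>k\<close>.\<close>
  have complete: "\<exists>m k l. u m = Some k \<and> (k, m, l, n) \<in> S"
    if "x \<in> E" "is_name d r K \<alpha> u x" for x u n
    using S that unfolding metric_approximation_system_def is_name_def by meson
  show ?thesis
  proof (cases "S = {}")
    case True
    \<comment> \<open>No total function enumerates the empty set, hence the separate case. By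
      \<open>complete\<close>, no point of \<open>E\<close> has a name then, and the nowhere defined
      operator qualifies vacuously.\<close>
    have "enumeration_operator {} A = {}" for A
      by (simp add: enumeration_operator_def)
    then have "recursive_operator (\<lambda>u. Map.empty)"
      unfolding recursive_operator_def by (intro exI[of _ "{}"]) (simp add: recursively_enumerable_def)
    then show ?thesis
      unfolding computable_map_def using complete True by blast
  next
    case False
    then obtain g where g: "recursive_function g" "quad_encode ` S = range g"
      using re by (auto simp: recursively_enumerable4_def recursively_enumerable_def)
    let ?q = "\<lambda>s. quad_decode (g s)"
    have "range ?q = quad_decode ` quad_encode ` S"
      by (simp add: g(2) image_image)
    then have q: "range ?q = S"
      by (simp add: image_image)
    have "is_name e r L \<beta> (search_operator ?q u) (f x)"
      if x: "x \<in> E" and u: "is_name d r K \<alpha> u x" for x u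
      unfolding is_name_def
    proof
      fix n
      obtain m k l where mkl: "u m = Some k" "(k, m, l, n) \<in> S"
        using complete x u by blast
      then obtain s where "?q s = (k, m, l, n)"
        using q by (metis imageE)
      moreover have "u t \<noteq> None" for t
        using u by (metis is_name_def option.distinct(1))
      ultimately obtain s' k' m' l' where s': "search_operator ?q u n = Some l'"
        "?q s' = (k', m', l', n)" "u m' = Some k'"
        using search_operator_total mkl(1) by metis
      \<comment> \<open>The search may stop at a quadruple other than the one supplied by
        \<open>complete\<close>. It is still listed by \<open>?q\<close>, hence lies in
        \<open>S\<close>, and condition (a) makes its output accurate.\<close>
      have mem: "(k', m', l', n) \<in> S"
        using q s'(2) by (metis rangeI)
      moreover have "d (\<alpha> k') x < real_of_rat (r m')"
        using u s'(3) unfolding is_name_def by (metis option.inject)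
      ultimately have "e (\<beta> l') (f x) < real_of_rat (r n)"
        using accurate x by blast
      moreover have "l' \<in> L"
        using S mem by (auto simp: metric_approximation_system_def)
      ultimately show "\<exists>l\<in>L. search_operator ?q u n = Some l \<and> e (\<beta> l) (f x) < real_of_rat (r n)"
        using s'(1) by blast
    qed
    then show ?thesis
      unfolding computable_map_def using recursive_operator_search_operator[OF g(1)] by blast
  qed
qed

end
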